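(* Let $q=p^s$ with $p$ an odd prime and $s\ge1$, let $k\geq1$ be an integer, let $b\in\mathbb{F}_q^*$, and let $$\widetilde N^*(k,b)=\#\{(x_1,\dots,x_k)\in(\mathbb{F}_q^* )^k\mid x_1^2+\cdots+x_k^2=b,\ x_i\ne x_j\text{ for all }i\neq j\}.$$ (1) If either $p\equiv1\pmod4$, or $p\equiv3\pmod4$ and $s$ is even, then $$\widetilde N^*(k,b)=\frac{(q-1)_k}{q}-\frac{(-1)^k}{2q}\Big\{(1-\sqrt q)A_{k,b}(1-\sqrt q,1+\sqrt q,1-q)+(1+\sqrt q)A_{k,b}(1+\sqrt q,1-\sqrt q,1-q)\Big\}.$$ (2) If $p\equiv3\pmod4$ and $s$ is odd, then $$\widetilde N^*(k,b)=\frac{(q-1)_k}{q}-\frac{(-1)^k}{2q}\Big\{(1+\sqrt q i)A_{k,b}(1-\sqrt q i,1+\sqrt q i,1-q)+(1-\sqrt q i)A_{k,b}(1+\sqrt q i,1-\sqrt q i,1-q)\Big\},$$ where $i=\sqrt{-1}$.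
   Context: $(x)_k=x(x-1)\cdots(x-k+1)$. $\chi$ denotes the quadratic character of $\mathbb{F}_q^*$, and for an integer $j$, $\chi(j)$ means $\chi$ evaluated at the image of $j$ in $\mathbb{F}_q$. For integers $c_1,\dots,c_k\geq 0$ with $\sum_j jc_j=k$, let $N(c_1,\dots,c_k)=\frac{k!}{1^{c_1}c_1!\,2^{c_2}c_2!\cdots k^{c_k}c_k!}$. For $b\in\mathbb{F}_q^*$ and complex $u,v,w$, define $$A_{k,b}(u,v,w)=\sum_{c_1,\dots,c_k\ge 0,\ \sum_j jc_j=k}N(c_1,\dots,c_k)\,t_1^{c_1}\cdots t_k^{c_k},$$ where $t_j=u$ if $p\nmid j$ and $\chi(j)=\chi(b)$; $t_j=v$ if $p\nmid j$ and $\chi(j)=-\chi(b)$; $t_j=w$ if $p\mid j$. *)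

theory Defs
  imports
    Complex_Main
    "HOL-Library.FuncSet"
    "HOL-Library.Cardinality"
    "HOL-Computational_Algebra.Primes"
begin

definition falling_fact :: "'a::comm_ring_1 \<Rightarrow> nat \<Rightarrow> 'a" where
  "falling_fact x k = (\<Prod>i<k. x - of_nat i)"

definition quadratic_char :: "'a::field \<Rightarrow> int" where
  "quadratic_char x = (if x = 0 then 0 else if \<exists>y. x = y ^ 2 then 1 else - 1)"

text \<open>Tuples \<open>(c\<^sub>1, \<dots>, c\<^sub>k)\<close> are functions that are \<open>undefined\<close> outside \<open>{1..k}\<close>,
  so that each tuple is represented exactly once.\<close>

definition cycle_types :: "nat \<Rightarrow> (nat \<Rightarrow> nat) set" where
  "cycle_types k = {c \<in> {1..k} \<rightarrow>\<^sub>E UNIV. (\<Sum>j=1..k. j * c j) = k}"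

lemma finite_cycle_types: "finite (cycle_types k)"
proof (rule finite_subset)
  show "cycle_types k \<subseteq> {1..k} \<rightarrow>\<^sub>E {0..k}"
  proof
    fix c assume c: "c \<in> cycle_types k"
    have "c i \<le> k" if i: "i \<in> {1..k}" for i
    proof -
      have "c i \<le> i * c i" using i by simp
      also have "\<dots> \<le> (\<Sum>j=1..k. j * c j)"
        using i by (intro member_le_sum) auto
      also have "\<dots> = k" using c by (simp add: cycle_types_def)
      finally show ?thesis .
    qed
    then show "c \<in> {1..k} \<rightarrow>\<^sub>E {0..k}"
      using c by (auto simp: cycle_types_def PiE_iff)
  qed
qed (simp add: finite_PiE)

definition cycle_type_count :: "nat \<Rightarrow> (nat \<Rightarrow> nat) \<Rightarrow> complex" where
  "cycle_type_count k c = fact k / (\<Prod>j=1..k. of_nat j ^ c j * fact (c j))"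

text \<open>Here \<open>p\<close> is the characteristic of the field and \<open>b \<noteq> 0\<close>; hence the last branch of
  \<open>cycle_weight\<close> is exactly the case \<open>\<chi>(j) = - \<chi>(b)\<close>.\<close>

definition cycle_weight ::
    "nat \<Rightarrow> 'a::field \<Rightarrow> complex \<Rightarrow> complex \<Rightarrow> complex \<Rightarrow> nat \<Rightarrow> complex" where
  "cycle_weight p b u v w j =
     (if p dvd j then w
      else if quadratic_char (of_nat j :: 'a) = quadratic_char b then u
      else v)"

definition A_poly ::
    "nat \<Rightarrow> nat \<Rightarrow> 'a::field \<Rightarrow> complex \<Rightarrow> complex \<Rightarrow> complex \<Rightarrow> complex" where
  "A_poly p k b u v w =
     (\<Sum>c\<in>cycle_types k. cycle_type_count k c * (\<Prod>j=1..k. cycle_weight p b u v w j ^ c j))"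

definition N_star :: "nat \<Rightarrow> 'a::field \<Rightarrow> nat" where
  "N_star k b = card {x \<in> {1..k} \<rightarrow>\<^sub>E (UNIV - {0}).
     (\<Sum>i=1..k. x i ^ 2) = b \<and> (\<forall>i\<in>{1..k}. \<forall>j\<in>{1..k}. i \<noteq> j \<longrightarrow> x i \<noteq> x j)}"

end

theory Submission
  imports Defs "HOL-Number_Theory.Residues" "HOL-Computational_Algebra.Polynomial"
begin

text \<open>Detecting \<open>x\<^sub>1\<^sup>2 + \<dots> + x\<^sub>k\<^sup>2 = b\<close> with a nontrivial additive character \<open>\<psi>\<close> gives
  \<open>q N = \<Sum>\<^sub>a \<psi>(-ab) D\<^sub>k(a)\<close>, where \<open>D\<^sub>k(a)\<close> is \<open>k!\<close> times the \<open>k\<close>-th elementary symmetric function of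
  the numbers \<open>\<psi>(ax\<^sup>2)\<close>, \<open>x \<noteq> 0\<close>. By Newton's identities \<open>D\<^sub>k(a)\<close> is a cycle index polynomial in the
  power sums, and the \<open>j\<close>-th power sum is \<open>\<chi>(ja) G - 1\<close> or \<open>q - 1\<close>, with \<open>G\<close> the quadratic Gauss sum.
  So \<open>D\<^sub>k(a)\<close> depends only on \<open>\<chi>(a)\<close>, and the sums of \<open>\<psi>\<close> over squares and over nonsquares are
  again given by \<open>G\<close>. The formula is invariant under \<open>G \<mapsto> -G\<close>, hence \<open>G\<^sup>2 = \<chi>(-1) q\<close> suffices and the
  sign of \<open>G\<close> is not needed.\<close>

section \<open>Newton's identities and the cycle index\<close>

text \<open>This is \<open>k!\<close> times the \<open>k\<close>-th elementary symmetric polynomial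
  in the values of \<open>y\<close> on \<open>S\<close>. The recursion picks the first entry of an
  injective tuple, so that no division occurs.\<close>

fun distinct_sum :: "('b \<Rightarrow> 'a::comm_ring_1) \<Rightarrow> nat \<Rightarrow> 'b set \<Rightarrow> 'a" where
  "distinct_sum y 0 S = 1"
| "distinct_sum y (Suc k) S = (\<Sum>x\<in>S. y x * distinct_sum y k (S - {x}))"

text \<open>An injective tuple on \<open>insert i I\<close> is its entry \<open>x\<close> at
  \<open>i\<close> together with an injective tuple on \<open>I\<close> that avoids
  \<open>x\<close>. This matches the recursion; \<open>S\<close> varies in the induction because it
  loses \<open>x\<close>.\<close>

lemma sum_inj_tuples_eq_distinct_sum:
  assumes "finite I" "finite S"
  shows "(\<Sum>f\<in>{f \<in> I \<rightarrow>\<^sub>E S. inj_on f I}. \<Prod>i\<in>I. y (f i)) = distinct_sum y (card I) S"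
  using assms
proof (induction I arbitrary: S rule: finite_induct)
  case (insert i I)
  let ?T = "\<lambda>I S. {f \<in> I \<rightarrow>\<^sub>E S. inj_on f I}"
  have fin: "finite (?T I (S - {x}))" for x
    by (rule finite_subset[OF _ finite_PiE[OF insert.hyps(1)]]) (use insert.prems in auto)
  have "(\<Sum>f\<in>?T (insert i I) S. \<Prod>j\<in>insert i I. y (f j)) =
      (\<Sum>(x, g)\<in>(SIGMA x:S. ?T I (S - {x})). y x * (\<Prod>j\<in>I. y (g j)))"
  proof (rule sum.reindex_bij_witness[of _ "\<lambda>(x, g). g(i := x)" "\<lambda>f. (f i, f(i := undefined))"])
    fix f assume f: "f \<in> ?T (insert i I) S"
    show "(case (f i, f(i := undefined)) of (x, g) \<Rightarrow> g(i := x)) = f"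
      by simp
    show "(f i, f(i := undefined)) \<in> (SIGMA x:S. ?T I (S - {x}))"
      using f insert.hyps(2) by (auto simp: PiE_iff extensional_def inj_on_def)
    have "(\<Prod>j\<in>I. y ((f(i := undefined)) j)) = (\<Prod>j\<in>I. y (f j))"
      using insert.hyps(2) by (intro prod.cong) auto
    then show "(case (f i, f(i := undefined)) of (x, g) \<Rightarrow> y x * (\<Prod>j\<in>I. y (g j))) =
        (\<Prod>j\<in>insert i I. y (f j))"
      using insert.hyps by simp
  next
    fix z assume z: "z \<in> (SIGMA x:S. ?T I (S - {x}))"
    then obtain x g where xg: "z = (x, g)" "x \<in> S" "g \<in> I \<rightarrow>\<^sub>E S - {x}" "inj_on g I"
      by auto
    have "g i = undefined"
      using xg(3) insert.hyps(2) by (auto simp: PiE_iff extensional_def)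
    then show "((case z of (x, g) \<Rightarrow> g(i := x)) i, (case z of (x, g) \<Rightarrow> g(i := x))(i := undefined)) = z"
      using xg by auto
    have "inj_on (g(i := x)) (insert i I)"
      using xg insert.hyps(2) by (auto simp: inj_on_def PiE_iff)
    then show "(case z of (x, g) \<Rightarrow> g(i := x)) \<in> ?T (insert i I) S"
      using xg by (auto simp: PiE_iff extensional_def)
  qed
  also have "\<dots> = (\<Sum>x\<in>S. y x * (\<Sum>g\<in>?T I (S - {x}). \<Prod>j\<in>I. y (g j)))"
    using fin insert.prems by (subst sum.Sigma[symmetric]) (auto simp: sum_distrib_left)
  also have "\<dots> = distinct_sum y (card (insert i I)) S"
    using insert by simp
  finally show ?case .
qed auto

text \<open>An injective \<open>k\<close>-tuple either avoids \<open>x\<close> or takes the value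
  \<open>x\<close> at exactly one of its \<open>k\<close> positions. For \<open>k = 0\<close> the
  factor \<open>of_nat k\<close> kills the term with the truncated \<open>k - 1\<close>.\<close>

lemma distinct_sum_remove:
  assumes "finite S" "x \<in> S"
  shows "distinct_sum y k S =
    distinct_sum y k (S - {x}) + of_nat k * y x * distinct_sum y (k - 1) (S - {x})"
  using assms
proof (induction k arbitrary: S)
  case (Suc k)
  let ?D = "distinct_sum y"
  have "?D (Suc k) S = y x * ?D k (S - {x}) + (\<Sum>z\<in>S - {x}. y z * ?D k (S - {z}))"
    using Suc.prems by (simp add: sum.remove)
  also have "(\<Sum>z\<in>S - {x}. y z * ?D k (S - {z})) =
      (\<Sum>z\<in>S - {x}. y z * ?D k (S - {x} - {z})
        + of_nat k * y x * (y z * ?D (k - 1) (S - {x} - {z})))"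
  proof (rule sum.cong)
    fix z assume z: "z \<in> S - {x}"
    have "?D k (S - {z}) = ?D k (S - {z} - {x}) + of_nat k * y x * ?D (k - 1) (S - {z} - {x})"
      using Suc.prems z by (intro Suc.IH) auto
    moreover have "S - {z} - {x} = S - {x} - {z}"
      by auto
    ultimately show "y z * ?D k (S - {z}) = y z * ?D k (S - {x} - {z})
        + of_nat k * y x * (y z * ?D (k - 1) (S - {x} - {z}))"
      by (simp add: algebra_simps)
  qed simp
  \<comment> \<open>The second part folds back by the recursion only if \<open>k - 1\<close> is a
    true predecessor. For \<open>k = 0\<close> its factor \<open>of_nat k\<close> vanishes.\<close>
  also have "\<dots> = ?D (Suc k) (S - {x}) + of_nat k * y x * ?D k (S - {x})"
  proof (cases k)
    case (Suc l)
    then show ?thesis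
      by (simp only: sum.distrib sum_distrib_left[symmetric] distinct_sum.simps diff_Suc_1)
  qed simp
  finally show ?case
    by (simp add: algebra_simps)
qed simp

text \<open>This evaluates the term \<open>a = 0\<close> of the character sum, where every
  \<open>y\<close>-value is 1.\<close>

lemma distinct_sum_const_one:
  assumes "finite S"
  shows "distinct_sum (\<lambda>_. 1) k S = (falling_fact (of_nat (card S)) k :: 'a::comm_ring_1)"
  using assms
proof (induction k arbitrary: S)
  case (Suc k)
  have "distinct_sum (\<lambda>_. 1) (Suc k) S = (\<Sum>x\<in>S. falling_fact (of_nat (card (S - {x}))) k :: 'a)"
    using Suc by simp
  also have "\<dots> = (\<Sum>x\<in>S. falling_fact (of_nat (card S) - 1) k)"
  proof (rule sum.cong)
    fix x assume "x \<in> S"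
    then have "card S = Suc (card (S - {x}))"
      using Suc.prems by (metis card_Suc_Diff1)
    then show "falling_fact (of_nat (card (S - {x}))) k = falling_fact (of_nat (card S) - 1 :: 'a) k"
      by simp
  qed simp
  also have "\<dots> = falling_fact (of_nat (card S)) (Suc k)"
    by (simp add: falling_fact_def prod.lessThan_Suc_shift algebra_simps del: prod.lessThan_Suc)
  finally show ?case .
qed (simp add: falling_fact_def)

text \<open>Solving \<open>distinct_sum_remove\<close> for the sum over \<open>S - {x}\<close>
  trades the deleted point for one more power of \<open>y x\<close> and a smaller \<open>k\<close>.
  Iteration leaves only power sums and sums over all of \<open>S\<close>; \<open>j\<close> is
  arbitrary because the exponent grows.\<close>

lemma sum_power_distinct_sum_remove:
  fixes y :: "'b \<Rightarrow> 'a::field_char_0"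
  assumes "finite S"
  shows "(\<Sum>x\<in>S. y x ^ Suc j * distinct_sum y k (S - {x})) / fact k =
    (\<Sum>i\<le>k. (-1) ^ i * (\<Sum>x\<in>S. y x ^ Suc (j + i)) * (distinct_sum y (k - i) S / fact (k - i)))"
proof (induction k arbitrary: j)
  case (Suc k)
  let ?D = "distinct_sum y" and ?p = "\<lambda>j. \<Sum>x\<in>S. y x ^ j"
  have "(\<Sum>x\<in>S. y x ^ Suc j * ?D (Suc k) (S - {x})) =
      (\<Sum>x\<in>S. y x ^ Suc j * ?D (Suc k) S - of_nat (Suc k) * (y x ^ Suc (Suc j) * ?D k (S - {x})))"
  proof (rule sum.cong)
    fix x assume "x \<in> S"
    from distinct_sum_remove[OF assms this, of y "Suc k"]
    show "y x ^ Suc j * ?D (Suc k) (S - {x}) =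
      y x ^ Suc j * ?D (Suc k) S - of_nat (Suc k) * (y x ^ Suc (Suc j) * ?D k (S - {x}))"
      by (simp add: algebra_simps del: distinct_sum.simps)
  qed simp
  also have "\<dots> = ?p (Suc j) * ?D (Suc k) S
      - of_nat (Suc k) * (\<Sum>x\<in>S. y x ^ Suc (Suc j) * ?D k (S - {x}))"
    by (simp only: sum_subtractf sum_distrib_left sum_distrib_right)
  finally have "(\<Sum>x\<in>S. y x ^ Suc j * ?D (Suc k) (S - {x})) / fact (Suc k) =
      ?p (Suc j) * (?D (Suc k) S / fact (Suc k))
      - (\<Sum>x\<in>S. y x ^ Suc (Suc j) * ?D k (S - {x})) / fact k"
    by (simp add: field_simps del: distinct_sum.simps of_nat_Suc power_Suc)
  \<comment> \<open>The first summand is the term \<open>i = 0\<close>; the induction hypothesis at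
    \<open>Suc j\<close> supplies the others, with index shifted and sign reversed.\<close>
  also have "\<dots> = (\<Sum>i\<le>Suc k. (-1) ^ i * ?p (Suc (j + i)) * (?D (Suc k - i) S / fact (Suc k - i)))"
    unfolding Suc.IH[of "Suc j"]
    by (subst sum.atMost_Suc_shift) (simp add: sum_negf[symmetric] del: distinct_sum.simps(2) fact_Suc power_Suc, simp)
  finally show ?case .
qed simp

text \<open>The case \<open>j = 0\<close> of the previous lemma, whose left side is then the
  recursion for \<open>distinct_sum y (Suc k) S\<close>. The sign makes \<open>f k\<close> the
  coefficient of \<open>z^k\<close> in the product of all \<open>1 - y x * z\<close>, and gives the
  recurrence the shape of the one for \<open>cycle_index\<close>.\<close>

lemma distinct_sum_newton:
  fixes y :: "'b \<Rightarrow> 'a::field_char_0"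
  assumes "finite S"
  defines "f \<equiv> \<lambda>k. (-1) ^ k * distinct_sum y k S / fact k"
  shows "of_nat (Suc k) * f (Suc k) = (\<Sum>i\<le>k. - (\<Sum>x\<in>S. y x ^ Suc i) * f (k - i))"
proof -
  have "of_nat (Suc k) * f (Suc k) =
      (-1) ^ Suc k * ((\<Sum>x\<in>S. y x ^ Suc 0 * distinct_sum y k (S - {x})) / fact k)"
    by (simp add: f_def del: of_nat_Suc)
  also have "\<dots> = (\<Sum>i\<le>k. - (\<Sum>x\<in>S. y x ^ Suc i) * f (k - i))"
    unfolding sum_power_distinct_sum_remove[OF assms(1)]
  proof (subst sum_distrib_left, rule sum.cong)
    fix i assume "i \<in> {..k}"
    then obtain l where l: "k = i + l"
      using le_Suc_ex by auto
    have "(-1 :: 'a) ^ i * (-1) ^ i = 1"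
      by (simp flip: power_mult_distrib)
    then have "(-1) ^ Suc k * (-1) ^ i = - ((-1 :: 'a) ^ l)"
      by (simp add: l power_add mult.assoc mult.left_commute)
    then show "(-1) ^ Suc k * ((-1) ^ i * (\<Sum>x\<in>S. y x ^ Suc (0 + i)) *
        (distinct_sum y (k - i) S / fact (k - i))) = - (\<Sum>x\<in>S. y x ^ Suc i) * f (k - i)"
      by (simp add: f_def l mult.assoc [symmetric])
  qed simp
  finally show ?thesis .
qed

text \<open>With the number \<open>M\<close> of coordinates decoupled from the weight \<open>k\<close>, lowering one coordinate
  keeps the index set and yields a recurrence in \<open>k\<close> alone.\<close>

definition weight_tuples :: "nat \<Rightarrow> nat \<Rightarrow> (nat \<Rightarrow> nat) set" where
  "weight_tuples M k = {c \<in> {1..M} \<rightarrow>\<^sub>E UNIV. (\<Sum>j=1..M. j * c j) = k}"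

lemma finite_weight_tuples: "finite (weight_tuples M k)"
proof (rule finite_subset)
  show "weight_tuples M k \<subseteq> {1..M} \<rightarrow>\<^sub>E {0..k}"
  proof
    fix c assume c: "c \<in> weight_tuples M k"
    have "c i \<le> k" if i: "i \<in> {1..M}" for i
    proof -
      have "c i \<le> i * c i" using i by simp
      also have "\<dots> \<le> (\<Sum>j=1..M. j * c j)"
        using i by (intro member_le_sum) auto
      finally show ?thesis using c by (simp add: weight_tuples_def)
    qed
    then show "c \<in> {1..M} \<rightarrow>\<^sub>E {0..k}"
      using c by (auto simp: weight_tuples_def PiE_iff)
  qed
qed (simp add: finite_PiE)

text \<open>The coefficient of \<open>z^k\<close> in the exponential of the sum of
  \<open>t j * z^j / j\<close> over \<open>1 \<le> j \<le> M\<close>. For \<open>M \<ge> k\<close>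
  it is the cycle index of the symmetric group on \<open>k\<close> letters.\<close>

definition cycle_index :: "(nat \<Rightarrow> 'a::field_char_0) \<Rightarrow> nat \<Rightarrow> nat \<Rightarrow> 'a" where
  "cycle_index t M k = (\<Sum>c\<in>weight_tuples M k. \<Prod>j=1..M. (t j / of_nat j) ^ c j / fact (c j))"

lemma cycle_index_0: "cycle_index t M 0 = 1"
proof -
  have "weight_tuples M 0 = {\<lambda>j\<in>{1..M}. 0}"
    by (auto simp: weight_tuples_def PiE_iff extensional_def restrict_def fun_eq_iff Suc_le_eq)
  then show ?thesis
    by (simp add: cycle_index_def)
qed

text \<open>The factor \<open>j * c j\<close> cancels against \<open>j\<close> and
  \<open>fact (c j)\<close> and leaves \<open>t j\<close> times the term of the tuple with
  \<open>c j\<close> lowered by one, whose weight is \<open>k - j\<close>.\<close>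

lemma sum_weight_tuples_part:
  fixes t :: "nat \<Rightarrow> 'a::field_char_0"
  assumes j: "j \<in> {1..M}"
  shows "(\<Sum>c\<in>weight_tuples M k. of_nat (j * c j) * (\<Prod>i=1..M. (t i / of_nat i) ^ c i / fact (c i)))
    = (if j \<le> k then t j * cycle_index t M (k - j) else 0)"
proof -
  let ?g = "\<lambda>c::nat \<Rightarrow> nat. \<Prod>i=1..M. (t i / of_nat i) ^ c i / fact (c i)"
  let ?h = "\<lambda>c::nat \<Rightarrow> nat. \<Prod>i\<in>{1..M}-{j}. (t i / of_nat i) ^ c i / fact (c i)"
  have weight: "(\<Sum>i=1..M. i * c i) = j * c j + (\<Sum>i\<in>{1..M}-{j}. i * c i)" for c :: "nat \<Rightarrow> nat"
    using j by (intro sum.remove) auto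
  have weight_upd: "(\<Sum>i=1..M. i * (c(j := x)) i) = j * x + (\<Sum>i\<in>{1..M}-{j}. i * c i)"
    for c :: "nat \<Rightarrow> nat" and x
    unfolding weight by (intro arg_cong2[where f = "(+)"] sum.cong) auto
  have split: "?g c = (t j / of_nat j) ^ c j / fact (c j) * ?h c" for c
    using j by (intro prod.remove) auto
  have upd: "?h (c(j := x)) = ?h c" for c x
    by (intro prod.cong) auto
  have "(\<Sum>c\<in>weight_tuples M k. of_nat (j * c j) * ?g c) =
      (\<Sum>c\<in>{c \<in> weight_tuples M k. c j \<noteq> 0}. of_nat (j * c j) * ?g c)"
    by (intro sum.mono_neutral_right finite_weight_tuples) auto
  also have "\<dots> = (if j \<le> k then t j * cycle_index t M (k - j) else 0)"
  proof (cases "j \<le> k")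
    case True
    \<comment> \<open>Dropping the tuples with \<open>c j = 0\<close> makes the lowering of
      \<open>c j\<close> invertible.\<close>
    have "(\<Sum>c\<in>{c \<in> weight_tuples M k. c j \<noteq> 0}. of_nat (j * c j) * ?g c) =
        (\<Sum>c\<in>weight_tuples M (k - j). t j * ?g c)"
    proof (rule sum.reindex_bij_witness[of _ "\<lambda>c. c(j := Suc (c j))" "\<lambda>c. c(j := c j - 1)"])
      fix c assume c: "c \<in> {c \<in> weight_tuples M k. c j \<noteq> 0}"
      then obtain m where m: "c j = Suc m"
        by (cases "c j") auto
      show "(c(j := c j - 1))(j := Suc ((c(j := c j - 1)) j)) = c"
        using m by auto
      show "c(j := c j - 1) \<in> weight_tuples M (k - j)"
        using c j m weight[of c] weight_upd[of c m] unfolding weight_tuples_def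
        by (auto simp: PiE_iff extensional_def simp del: fun_upd_apply) auto
      have "of_nat (j * c j) * ((t j / of_nat j) ^ c j / fact (c j)) =
          t j * ((t j / of_nat j) ^ m / fact m)"
        using j by (simp add: m field_simps del: of_nat_Suc mult_Suc_right)
      then show "t j * ?g (c(j := c j - 1)) = of_nat (j * c j) * ?g c"
        unfolding split upd using m by (simp only: mult.assoc [symmetric] fun_upd_same diff_Suc_1)
    next
      fix c assume c: "c \<in> weight_tuples M (k - j)"
      show "(c(j := Suc (c j)))(j := (c(j := Suc (c j))) j - 1) = c"
        by auto
      show "c(j := Suc (c j)) \<in> {c \<in> weight_tuples M k. c j \<noteq> 0}"
        using c j True weight[of c] weight_upd[of c "Suc (c j)"] unfolding weight_tuples_def
        by (auto simp: PiE_iff extensional_def simp del: fun_upd_apply) auto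
    qed
    then show ?thesis
      using True by (simp add: cycle_index_def sum_distrib_left)
  next
    case False
    have "c j = 0" if c: "c \<in> weight_tuples M k" for c
    proof (rule ccontr)
      assume "c j \<noteq> 0"
      then have "j * 1 \<le> j * c j"
        by (intro mult_le_mono2) simp
      also have "\<dots> \<le> k"
        using c weight[of c] by (simp add: weight_tuples_def)
      finally show False
        using False by simp
    qed
    then have "{c \<in> weight_tuples M k. c j \<noteq> 0} = {}"
      by auto
    then show ?thesis
      using False by (simp only: sum.empty if_False)
  qed
  finally show ?thesis .
qed

text \<open>Each tuple satisfies \<open>Suc k = (\<Sum>j=1..M. j * c j)\<close>; inserting this sum
  and swapping summations reduces to the previous lemma. The bound on \<open>M\<close> ensures that
  all parts up to \<open>Suc k\<close> are available.\<close>

lemma cycle_index_recurrence: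
  assumes "Suc k \<le> M"
  shows "of_nat (Suc k) * cycle_index t M (Suc k) =
    (\<Sum>i\<le>k. t (Suc i) * cycle_index t M (k - i))"
proof -
  let ?g = "\<lambda>c::nat \<Rightarrow> nat. \<Prod>i=1..M. (t i / of_nat i) ^ c i / fact (c i)"
  have "of_nat (Suc k) * cycle_index t M (Suc k) =
      (\<Sum>c\<in>weight_tuples M (Suc k). of_nat (\<Sum>j=1..M. j * c j) * ?g c)"
    unfolding cycle_index_def sum_distrib_left by (intro sum.cong) (auto simp: weight_tuples_def)
  also have "\<dots> = (\<Sum>c\<in>weight_tuples M (Suc k). \<Sum>j=1..M. of_nat (j * c j) * ?g c)"
    by (simp only: of_nat_sum sum_distrib_right)
  also have "\<dots> = (\<Sum>j=1..M. \<Sum>c\<in>weight_tuples M (Suc k). of_nat (j * c j) * ?g c)"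
    by (rule sum.swap)
  also have "\<dots> = (\<Sum>j=1..M. if j \<le> Suc k then t j * cycle_index t M (Suc k - j) else 0)"
    by (intro sum.cong sum_weight_tuples_part) auto
  also have "\<dots> = (\<Sum>j\<in>{1..Suc k}. t j * cycle_index t M (Suc k - j))"
    using assms by (intro sum.mono_neutral_cong_right) auto
  also have "\<dots> = (\<Sum>i\<le>k. t (Suc i) * cycle_index t M (k - i))"
    by (rule sum.reindex_bij_witness[of _ Suc "\<lambda>j. j - 1"]) auto
  finally show ?thesis .
qed

text \<open>Both sides satisfy Newton's recurrence, which determines them.\<close>

lemma distinct_sum_eq_cycle_index:
  fixes y :: "'b \<Rightarrow> 'a::field_char_0"
  assumes S: "finite S" and "k \<le> M"
    and t: "\<And>j. j > 0 \<Longrightarrow> t j = - (\<Sum>x\<in>S. y x ^ j)"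
  shows "(-1) ^ k * distinct_sum y k S = fact k * cycle_index t M k"
proof -
  have "(-1) ^ k * distinct_sum y k S / fact k = cycle_index t M k"
    using \<open>k \<le> M\<close>
  proof (induction k rule: less_induct)
    case (less k)
    show ?case
    proof (cases k)
      case (Suc l)
      have "of_nat (Suc l) * ((-1) ^ Suc l * distinct_sum y (Suc l) S / fact (Suc l)) =
          (\<Sum>i\<le>l. t (Suc i) * ((-1) ^ (l - i) * distinct_sum y (l - i) S / fact (l - i)))"
        by (subst distinct_sum_newton[OF S]) (simp add: t)
      also have "\<dots> = (\<Sum>i\<le>l. t (Suc i) * cycle_index t M (l - i))"
        using less Suc by (intro sum.cong arg_cong2[where f = "(*)"] less.IH) auto
      also have "\<dots> = of_nat (Suc l) * cycle_index t M (Suc l)"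
        using less Suc by (simp only: cycle_index_recurrence)
      finally show ?thesis
        using Suc by (simp only: mult_cancel_left of_nat_eq_0_iff) simp
    qed (simp add: cycle_index_0)
  qed
  then show ?thesis
    by (simp add: field_simps)
qed

text \<open>At \<open>M = k\<close> the index sets agree, and the denominator of
  \<open>cycle_type_count\<close> distributes over the factors.\<close>

lemma A_poly_eq_cycle_index:
  "A_poly p k b u v w = fact k * cycle_index (cycle_weight p b u v w) k k"
proof -
  have "cycle_type_count k c * (\<Prod>j=1..k. cycle_weight p b u v w j ^ c j) =
      fact k * (\<Prod>j=1..k. (cycle_weight p b u v w j / of_nat j) ^ c j / fact (c j))" for c
    by (simp add: cycle_type_count_def prod_dividef prod.distrib power_divide)
  then show ?thesis
    by (simp add: A_poly_def cycle_index_def cycle_types_def weight_tuples_def sum_distrib_left)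
qed

section \<open>Additive characters of a finite field\<close>

lemma CHAR_eq_of_CARD_prime_power:
  assumes "prime p" "CARD('a::{field,finite}) = p ^ s"
  shows "CHAR('a) = p"
proof -
  have "prime CHAR('a)"
    by (intro prime_CHAR_semidom finite_imp_CHAR_pos) simp
  moreover have "CHAR('a) dvd p ^ s"
    using CHAR_dvd_CARD[where 'a = 'a] assms by simp
  ultimately show ?thesis
    using assms(1) by (metis prime_dvd_power primes_dvd_imp_eq)
qed

text \<open>Multiplication by \<open>x\<close> permutes the nonzero elements, so it does not change
  their product.\<close>

lemma finite_field_power_CARD_minus_1:
  fixes x :: "'a::{field,finite}"
  assumes "x \<noteq> 0"
  shows "x ^ (CARD('a) - 1) = 1"
proof -
  have "(\<Prod>y\<in>UNIV - {0}. x * y) = \<Prod>(UNIV - {0 :: 'a})"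
    using assms by (intro prod.reindex_bij_witness[of _ "\<lambda>y. y / x" "\<lambda>y. x * y"]) auto
  then have "x ^ (CARD('a) - 1) * \<Prod>(UNIV - {0 :: 'a}) = 1 * \<Prod>(UNIV - {0})"
    by (simp add: prod.distrib)
  moreover have "\<Prod>(UNIV - {0 :: 'a}) \<noteq> 0"
    by simp
  ultimately show ?thesis
    by (simp only: mult_cancel_right) simp
qed

lemma finite_field_power_CARD:
  fixes x :: "'a::{field,finite}"
  shows "x ^ CARD('a) = x"
proof (cases "x = 0")
  case False
  have "x ^ CARD('a) = x * x ^ (CARD('a) - 1)"
    by (simp flip: power_Suc)
  then show ?thesis
    using finite_field_power_CARD_minus_1[OF False] by (simp only: mult_1_right)
qed simp

text \<open>The \<open>p\<close> multiples of 1 are distinct and fixed by Frobenius, while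
  \<open>X^p - X\<close> has at most \<open>p\<close> roots. Hence a Frobenius-fixed trace value has
  a representative below \<open>p\<close>.\<close>

lemma range_of_nat_eq_frobenius_fixed:
  assumes p: "prime p" "CHAR('a::{field,finite}) = p"
  shows "of_nat ` {..<p} = {x :: 'a. x ^ p = x}"
proof (rule card_seteq)
  have prime_char: "prime CHAR('a)"
    using p by simp
  have dream: "(1 + x) ^ p = 1 + x ^ p" for x :: 'a
    using freshmans_dream[OF prime_char p(2)[symmetric], of 1 x] by simp
  have "of_nat n ^ p = (of_nat n :: 'a)" for n
    by (induction n) (simp_all add: dream prime_gt_0_nat[OF p(1)])
  then show "of_nat ` {..<p} \<subseteq> {x :: 'a. x ^ p = x}"
    by auto
  have "inj_on (of_nat :: nat \<Rightarrow> 'a) {..<p}"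
    using p by (auto simp: inj_on_def of_nat_eq_iff_cong_CHAR cong_def)
  then have card: "card ((of_nat :: nat \<Rightarrow> 'a) ` {..<p}) = p"
    by (simp add: card_image)
  define P :: "'a poly" where "P = monom 1 p - monom 1 1"
  have "coeff P p = 1"
    using prime_gt_1_nat[OF p(1)] by (simp add: P_def)
  then have "P \<noteq> 0"
    by auto
  then have "card {x. poly P x = 0} \<le> degree P"
    by (rule card_poly_roots_bound)
  also have "degree P \<le> p"
    unfolding P_def using prime_gt_1_nat[OF p(1)]
    by (intro degree_diff_le) (simp_all add: degree_monom_eq)
  finally show "card {x :: 'a. x ^ p = x} \<le> card ((of_nat :: nat \<Rightarrow> 'a) ` {..<p})"
    by (simp add: card P_def poly_monom)
qed simp

text \<open>For \<open>q = p ^ s\<close> this is the absolute trace, and its values lie in the prime field.\<close>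

definition frobenius_trace :: "nat \<Rightarrow> nat \<Rightarrow> 'a::field \<Rightarrow> 'a" where
  "frobenius_trace p s x = (\<Sum>i<s. x ^ (p ^ i))"

lemma frobenius_trace_add:
  assumes "prime CHAR('a::field)"
  shows "frobenius_trace CHAR('a) s (x + y :: 'a) =
    frobenius_trace CHAR('a) s x + frobenius_trace CHAR('a) s y"
  unfolding frobenius_trace_def freshmans_dream'[OF assms refl] by (rule sum.distrib)

text \<open>Frobenius shifts the exponents \<open>p ^ i\<close> by one; the new last term
  \<open>x ^ (p ^ s)\<close> equals the lost first term \<open>x\<close>.\<close>

lemma frobenius_trace_power:
  fixes x :: "'a::{field,finite}"
  assumes "prime p" "CARD('a) = p ^ s"
  shows "frobenius_trace p s x ^ p = frobenius_trace p s x"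
proof -
  have char: "p = CHAR('a)"
    using CHAR_eq_of_CARD_prime_power[OF assms] by simp
  then have "prime CHAR('a)"
    using assms(1) by simp
  then have "frobenius_trace p s x ^ p = (\<Sum>i<s. (x ^ (p ^ i)) ^ p)"
    unfolding frobenius_trace_def using char by (rule freshmans_dream_sum)
  also have "\<dots> = (\<Sum>i<s. x ^ (p ^ Suc i))"
    by (simp add: mult.commute flip: power_mult)
  also have "\<dots> = (\<Sum>i<Suc s. x ^ (p ^ i)) - x"
    by (subst sum.lessThan_Suc_shift) simp
  also have "\<dots> = frobenius_trace p s x"
    using finite_field_power_CARD[of x] by (simp add: frobenius_trace_def assms(2))
  finally show ?thesis .
qed

text \<open>The trace is a nonzero polynomial of degree at most \<open>p ^ (s - 1)\<close>, too
  small for all \<open>p ^ s\<close> elements to be roots.\<close>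

lemma frobenius_trace_nontrivial:
  assumes "prime p" "CARD('a::{field,finite}) = p ^ s" "s \<ge> 1"
  shows "\<exists>x :: 'a. frobenius_trace p s x \<noteq> 0"
proof (rule ccontr)
  assume *: "\<not> ?thesis"
  have p: "p > 1"
    using assms(1) by (rule prime_gt_1_nat)
  define P :: "'a poly" where "P = (\<Sum>i<s. monom 1 (p ^ i))"
  have "poly P x = frobenius_trace p s x" for x
    by (simp add: P_def poly_sum poly_monom frobenius_trace_def)
  with * have zero: "{x. poly P x = 0} = UNIV"
    by auto
  \<comment> \<open>The exponents \<open>p ^ i\<close> are distinct since \<open>p > 1\<close>, so
    only the monomial with \<open>i = s - 1\<close> contributes.\<close>
  have "coeff P (p ^ (s - 1)) = (\<Sum>i<s. if i = s - 1 then 1 else 0)"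
    unfolding P_def coeff_sum using p by (intro sum.cong) auto
  also have "\<dots> = 1"
    using assms(3) by simp
  finally have "P \<noteq> 0"
    by auto
  then have "CARD('a) \<le> degree P"
    using card_poly_roots_bound[of P] zero by simp
  also have "degree P \<le> p ^ (s - 1)"
    unfolding P_def
  proof (rule degree_sum_le)
    fix i assume "i \<in> {..<s}"
    then have "p ^ i \<le> p ^ (s - 1)"
      using p by (intro power_increasing) auto
    then show "degree (monom (1 :: 'a) (p ^ i)) \<le> p ^ (s - 1)"
      by (simp add: degree_monom_eq)
  qed simp
  also have "\<dots> < p ^ s"
    using p assms(3) by (intro power_strict_increasing) auto
  finally show False
    using assms(2) by simp
qed

section \<open>Nontrivial additive characters and their orthogonality\<close>

locale additive_character =
  fixes \<psi> :: "'a::{field,finite} \<Rightarrow> complex"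
  assumes psi_add: "\<psi> (x + y) = \<psi> x * \<psi> y"
    and psi_0: "\<psi> 0 = 1"
    and nontrivial: "\<exists>x. \<psi> x \<noteq> 1"

text \<open>The character is \<open>x \<mapsto> exp(2 pi i tr(x) / p)\<close>, with the trace lifted
  to its representative \<open>n x < p\<close>. It is additive because \<open>w\<close> depends only
  on residues modulo \<open>p\<close>.\<close>

lemma additive_character_exists:
  assumes "prime p" "CARD('a::{field,finite}) = p ^ s" "s \<ge> 1"
  shows "\<exists>\<psi> :: 'a \<Rightarrow> complex. additive_character \<psi>"
proof -
  let ?tr = "frobenius_trace p s :: 'a \<Rightarrow> 'a"
  define w where "w = (\<lambda>n. cis (2 * pi * real n / real p))"
  have p: "p > 1"
    using assms(1) by (rule prime_gt_1_nat)
  have char: "CHAR('a) = p"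
    using assms(1,2) by (rule CHAR_eq_of_CARD_prime_power)
  note tr_add = frobenius_trace_add[where 'a = 'a, unfolded char, OF assms(1)]
  have w_add: "w (m + n) = w m * w n" for m n
    by (simp add: w_def cis_mult add_divide_distrib algebra_simps)
  have w_inj: "inj_on w {..<p}"
    using bij_betw_roots_unity[of p] p by (simp add: w_def bij_betw_def)
  have "w (p * d) = 1" for d
    using p cis_multiple_2pi[of d] by (simp add: w_def mult_ac)
  then have w_mod: "w (n mod p) = w n" for n
    using w_add[of "n mod p" "p * (n div p)"] by simp
  have "\<exists>n<p. of_nat n = ?tr x" for x
    using frobenius_trace_power[OF assms(1,2), of x] range_of_nat_eq_frobenius_fixed[OF assms(1) char]
    by (auto simp: set_eq_iff image_iff) (metis lessThan_iff)
  then obtain n where n: "\<And>x. n x < p" "\<And>x. of_nat (n x) = ?tr x"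
    by metis
  have "[n (x + y) = n x + n y] (mod p)" for x y
    unfolding char[symmetric] of_nat_eq_iff_cong_CHAR[where 'a = 'a, symmetric]
    by (simp add: n tr_add)
  then have add: "w (n (x + y)) = w (n x) * w (n y)" for x y
    by (metis w_mod w_add cong_def)
  have n0: "n x = 0" if "?tr x = 0" for x
    using that n[of x] char by (metis of_nat_eq_0_iff_char_dvd nat_dvd_not_less neq0_conv)
  have "?tr 0 = 0"
    using p by (simp add: frobenius_trace_def power_0_left)
  then have zero: "w (n 0) = 1"
    using n0 by (simp add: w_def)
  obtain x where x: "?tr x \<noteq> 0"
    using frobenius_trace_nontrivial[OF assms] by blast
  have w0: "w 0 = 1"
    by (simp add: w_def)
  \<comment> \<open>The values of \<open>w\<close> below \<open>p\<close> are distinct roots of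
    unity, so \<open>w (n x) = 1\<close> would force \<open>n x = 0\<close> and thus trace
    0.\<close>
  have "w (n x) \<noteq> 1"
  proof
    assume "w (n x) = 1"
    then have "w (n x) = w 0"
      by (simp only: w0)
    then have "n x = 0"
      by (rule inj_onD[OF w_inj]) (use n(1)[of x] p in auto)
    then show False
      using x n(2)[of x] by simp
  qed
  then have "additive_character (\<lambda>x. w (n x))"
    using add zero by unfold_locales blast+
  then show ?thesis
    by blast
qed

context additive_character
begin

lemma psi_sum: "\<psi> (sum f A) = (\<Prod>x\<in>A. \<psi> (f x))"
  by (induction A rule: infinite_finite_induct) (auto simp: psi_0 psi_add)

lemma psi_of_nat_mult: "\<psi> (of_nat n * x) = \<psi> x ^ n"
  by (induction n) (auto simp: psi_0 psi_add algebra_simps)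

text \<open>Translation by \<open>z\<close> with \<open>\<psi> z \<noteq> 1\<close> multiplies the
  sum by \<open>\<psi> z\<close> but only permutes its terms.\<close>

lemma sum_psi: "(\<Sum>x\<in>UNIV. \<psi> x) = 0"
proof -
  obtain z where z: "\<psi> z \<noteq> 1"
    using nontrivial by blast
  have "\<psi> z * (\<Sum>x\<in>UNIV. \<psi> x) = (\<Sum>x\<in>UNIV. \<psi> (z + x))"
    by (simp add: psi_add sum_distrib_left)
  also have "\<dots> = (\<Sum>x\<in>UNIV. \<psi> x)"
    by (rule sum.reindex_bij_witness[of _ "\<lambda>x. x - z" "\<lambda>x. z + x"]) auto
  finally show ?thesis
    using z by auto
qed

lemma sum_psi_mult: "(\<Sum>x\<in>UNIV. \<psi> (a * x)) = (if a = 0 then of_nat CARD('a) else 0)"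
proof (cases "a = 0")
  case False
  have "(\<Sum>x\<in>UNIV. \<psi> (a * x)) = (\<Sum>x\<in>UNIV. \<psi> x)"
    using False by (intro sum.reindex_bij_witness[of _ "\<lambda>x. x / a" "\<lambda>x. a * x"]) auto
  then show ?thesis
    using False sum_psi by simp
qed (simp add: psi_0)

end

section \<open>Squares and quadratic Gauss sums\<close>

definition nonzero_squares :: "'a::field set" where
  "nonzero_squares = {x. quadratic_char x = 1}"

definition nonsquares :: "'a::field set" where
  "nonsquares = {x. quadratic_char x = -1}"

lemma mem_nonzero_squares_iff: "x \<in> nonzero_squares \<longleftrightarrow> (\<exists>y. y \<noteq> 0 \<and> x = y ^ 2)"
  by (auto simp: nonzero_squares_def quadratic_char_def)

lemma quadratic_char_eq_0_iff: "quadratic_char x = 0 \<longleftrightarrow> x = 0"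
  by (auto simp: quadratic_char_def)

lemma nonzero_in_squares_or_nonsquares: "x \<noteq> 0 \<Longrightarrow> x \<in> nonzero_squares \<or> x \<in> nonsquares"
  by (auto simp: nonzero_squares_def nonsquares_def quadratic_char_def)

lemma nonzero_eq_squares_Un_nonsquares: "UNIV - {0} = nonzero_squares \<union> nonsquares"
  by (auto simp: nonzero_squares_def nonsquares_def quadratic_char_def)

lemma squares_Int_nonsquares: "nonzero_squares \<inter> nonsquares = {}"
  by (auto simp: nonzero_squares_def nonsquares_def)

lemma sum_nonzero_eq_squares_plus_nonsquares:
  fixes f :: "'a::{field,finite} \<Rightarrow> 'b::comm_monoid_add"
  shows "(\<Sum>x\<in>UNIV - {0}. f x) = (\<Sum>x\<in>nonzero_squares. f x) + (\<Sum>x\<in>nonsquares. f x)"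
  unfolding nonzero_eq_squares_Un_nonsquares
  by (rule sum.union_disjoint) (auto simp: squares_Int_nonsquares)

text \<open>Every nonzero square has exactly two roots \<open>r\<close> and \<open>- r\<close>,
  distinct because \<open>2 \<noteq> 0\<close>.\<close>

lemma sum_squares_nonzero:
  fixes f :: "'a::{field,finite} \<Rightarrow> 'b::semiring_1"
  assumes two: "(2 :: 'a) \<noteq> 0"
  shows "(\<Sum>x\<in>UNIV - {0}. f (x ^ 2)) = 2 * (\<Sum>y\<in>nonzero_squares. f y)"
proof -
  have "(\<Sum>x\<in>UNIV - {0}. f (x ^ 2)) =
      (\<Sum>y\<in>nonzero_squares. \<Sum>x\<in>{x \<in> UNIV - {0}. x ^ 2 = y}. f (x ^ 2))"
    by (rule sum.group[symmetric]) (auto simp: mem_nonzero_squares_iff)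
  also have "\<dots> = (\<Sum>y\<in>nonzero_squares. 2 * f y)"
  proof (rule sum.cong)
    fix y :: 'a assume "y \<in> nonzero_squares"
    then obtain r where r: "r \<noteq> 0" "y = r ^ 2"
      by (auto simp: mem_nonzero_squares_iff)
    have neq: "r \<noteq> - r"
      using r(1) two by (metis add_eq_0_iff mult_2 mult_eq_0_iff)
    have fibre: "{x \<in> UNIV - {0}. x ^ 2 = y} = {r, - r}"
      using r by (auto simp: power2_eq_iff)
    have "(\<Sum>x\<in>{r, - r}. f (x ^ 2)) = f (r ^ 2) + f ((- r) ^ 2)"
      by (subst sum.insert) (use neq in auto)
    then show "(\<Sum>x\<in>{x \<in> UNIV - {0}. x ^ 2 = y}. f (x ^ 2)) = 2 * f y"
      unfolding fibre by (simp only: r(2) power2_minus mult_2)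
  qed simp
  finally show ?thesis
    by (simp add: sum_distrib_left)
qed

lemma card_nonzero_squares:
  assumes "(2 :: 'a::{field,finite}) \<noteq> 0"
  shows "2 * card (nonzero_squares :: 'a set) = CARD('a) - 1"
  using sum_squares_nonzero[OF assms, of "\<lambda>_. 1 :: nat"] by simp

lemma card_nonsquares:
  assumes "(2 :: 'a::{field,finite}) \<noteq> 0"
  shows "card (nonsquares :: 'a set) = card (nonzero_squares :: 'a set)"
  using sum_nonzero_eq_squares_plus_nonsquares[of "\<lambda>_ :: 'a. 1 :: nat"] card_nonzero_squares[OF assms]
  by simp

lemma mult_nonzero_squares:
  assumes "a \<in> nonzero_squares" "b \<in> nonzero_squares"
  shows "a * b \<in> nonzero_squares"
proof -
  obtain x y where "x \<noteq> 0" "a = x ^ 2" "y \<noteq> 0" "b = y ^ 2"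
    using assms by (auto simp: mem_nonzero_squares_iff)
  then show ?thesis
    unfolding mem_nonzero_squares_iff by (intro exI[of _ "x * y"]) (simp add: power_mult_distrib)
qed

lemma mult_nonsquare_square:
  fixes a :: "'a::field"
  assumes a: "a \<in> nonsquares" and b: "b \<in> nonzero_squares"
  shows "a * b \<in> nonsquares"
proof (rule ccontr)
  assume "a * b \<notin> nonsquares"
  moreover have "a \<noteq> 0"
    using a by (auto simp: nonsquares_def quadratic_char_def)
  moreover obtain y where y: "y \<noteq> 0" "b = y ^ 2"
    using b by (auto simp: mem_nonzero_squares_iff)
  ultimately have "a * b \<in> nonzero_squares"
    using nonzero_in_squares_or_nonsquares[of "a * b"] by simp
  then obtain z where z: "z \<noteq> 0" "a * b = z ^ 2"
    by (auto simp: mem_nonzero_squares_iff)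
  then have "a = (z / y) ^ 2"
    using y by (simp add: power_divide field_simps)
  then have "a \<in> nonzero_squares"
    unfolding mem_nonzero_squares_iff using y(1) z(1) by (metis divide_eq_0_iff)
  then show False
    using a squares_Int_nonsquares by blast
qed

text \<open>The map is injective into \<open>nonsquares\<close>, which has as many elements as
  \<open>nonzero_squares\<close>.\<close>

lemma image_mult_nonsquare:
  fixes a :: "'a::{field,finite}"
  assumes "(2 :: 'a) \<noteq> 0" "a \<in> nonsquares"
  shows "(\<lambda>x. a * x) ` nonzero_squares = nonsquares"
proof (rule card_subset_eq)
  have "a \<noteq> 0"
    using assms(2) by (auto simp: nonsquares_def quadratic_char_def)
  then show "card ((\<lambda>x. a * x) ` nonzero_squares) = card (nonsquares :: 'a set)"
    by (simp add: card_nonsquares[OF assms(1)] card_image inj_on_def)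
qed (use assms mult_nonsquare_square in auto)

text \<open>By the previous lemma \<open>b = a * y ^ 2\<close> for some \<open>y\<close>, so
  \<open>a * b = (a * y) ^ 2\<close>.\<close>

lemma mult_nonsquares:
  fixes a :: "'a::{field,finite}"
  assumes "(2 :: 'a) \<noteq> 0" "a \<in> nonsquares" "b \<in> nonsquares"
  shows "a * b \<in> nonzero_squares"
proof -
  obtain y where y: "y \<noteq> 0" "b = a * y ^ 2"
    using image_mult_nonsquare[OF assms(1,2)] assms(3) by (force simp: mem_nonzero_squares_iff)
  moreover have "a \<noteq> 0"
    using assms(2) by (auto simp: nonsquares_def quadratic_char_def)
  ultimately show ?thesis
    by (auto simp: mem_nonzero_squares_iff power_mult_distrib power2_eq_square intro!: exI[of _ "a * y"])
qed

lemma quadratic_char_mult: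
  fixes a :: "'a::{field,finite}"
  assumes "(2 :: 'a) \<noteq> 0"
  shows "quadratic_char (a * b) = quadratic_char a * quadratic_char b"
proof (cases "a = 0 \<or> b = 0")
  case False
  then have "a \<in> nonzero_squares \<union> nonsquares" "b \<in> nonzero_squares \<union> nonsquares"
    by (auto simp flip: nonzero_eq_squares_Un_nonsquares)
  then show ?thesis
    using mult_nonzero_squares[of a b] mult_nonsquare_square[of a b] mult_nonsquare_square[of b a]
      mult_nonsquares[OF assms, of a b]
    by (auto simp: nonzero_squares_def nonsquares_def mult.commute)
qed (auto simp: quadratic_char_def)

text \<open>With \<open>CARD('a) = 2 * m + 1\<close>, the claim is that -1 is a square iff
  \<open>m\<close> is even. If \<open>-1 = y ^ 2\<close> then
  \<open>(-1) ^ m = y ^ (2 * m) = 1\<close>. Conversely some nonzero \<open>y\<close> is no root of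
  \<open>X^m - 1\<close>, so \<open>y ^ m = -1\<close>, and for \<open>m = 2 * l\<close> this is the
  square of \<open>y ^ l\<close>.\<close>

lemma quadratic_char_minus_one:
  assumes "odd CARD('a::{field,finite})" and two: "(2 :: 'a) \<noteq> 0"
  shows "quadratic_char (-1 :: 'a) = (if CARD('a) mod 4 = 1 then 1 else -1)"
proof -
  obtain m where m: "CARD('a) = 2 * m + 1"
    using assms(1) by (auto elim: oddE)
  have neq: "(1 :: 'a) \<noteq> -1"
    using two by (metis add_eq_0_iff one_add_one)
  have "(\<exists>y :: 'a. -1 = y ^ 2) \<longleftrightarrow> even m"
  proof
    assume "\<exists>y :: 'a. -1 = y ^ 2"
    then obtain y :: 'a where y: "-1 = y ^ 2"
      by blast
    have "y \<noteq> 0"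
      using y by auto
    have "(-1 :: 'a) ^ m = y ^ (CARD('a) - 1)"
      unfolding y by (simp add: m flip: power_mult)
    also have "\<dots> = 1"
      by (rule finite_field_power_CARD_minus_1) fact
    finally show "even m"
      using neq by (metis neg_one_odd_power)
  next
    assume "even m"
    then obtain l where l: "m = 2 * l"
      by blast
    \<comment> \<open>The field contains 0 and 1, hence \<open>m\<close> is positive; then
      \<open>X^m - 1\<close> is not zero and \<open>m < 2 * m\<close>.\<close>
    have "m > 0"
      using m card_mono[of UNIV "{0, 1 :: 'a}"] by simp
    define P :: "'a poly" where "P = monom 1 m - 1"
    have "coeff P m = 1"
      using \<open>m > 0\<close> by (simp add: P_def)
    then have "P \<noteq> 0"
      by auto
    then have "card {x. poly P x = 0} \<le> degree P"
      by (rule card_poly_roots_bound)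
    also have "degree P \<le> m"
      unfolding P_def by (intro degree_diff_le) (simp_all add: degree_monom_eq)
    also have "m < card (UNIV - {0 :: 'a})"
      using m \<open>m > 0\<close> by simp
    finally have "\<not> UNIV - {0 :: 'a} \<subseteq> {x. poly P x = 0}"
      by (metis card_mono finite_code not_le)
    then obtain y :: 'a where y: "y \<noteq> 0" "y ^ m \<noteq> 1"
      by (auto simp: P_def poly_monom)
    have "(y ^ m) ^ 2 = 1"
      using finite_field_power_CARD_minus_1[OF y(1)] by (simp add: m mult.commute flip: power_mult)
    then have "y ^ m = -1"
      using y(2) by (simp add: power2_eq_1_iff)
    then show "\<exists>y :: 'a. -1 = y ^ 2"
      by (intro exI[of _ "y ^ l"]) (simp add: l mult.commute flip: power_mult)
  qed
  moreover have "even m \<longleftrightarrow> CARD('a) mod 4 = 1"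
    unfolding m by presburger
  ultimately show ?thesis
    by (auto simp: quadratic_char_def)
qed

section \<open>Quadratic Gauss sums and the character sum for \<open>N_star\<close>\<close>

context additive_character
begin

definition gauss_sum :: "'a \<Rightarrow> complex" where
  "gauss_sum a = (\<Sum>x\<in>UNIV. \<psi> (a * x ^ 2))"

lemma sum_nonzero_psi_square: "(\<Sum>x\<in>UNIV - {0}. \<psi> (a * x ^ 2)) = gauss_sum a - 1"
  by (simp add: gauss_sum_def sum.remove[of UNIV "0 :: 'a"] psi_0)

lemma gauss_sum_0: "gauss_sum 0 = of_nat CARD('a)"
  by (simp add: gauss_sum_def psi_0)

lemma sum_nonzero_psi:
  assumes "a \<noteq> 0"
  shows "(\<Sum>x\<in>UNIV - {0}. \<psi> (a * x)) = -1"
  using sum_psi_mult[of a] assms by (simp add: sum.remove[of UNIV "0 :: 'a"] psi_0 add_eq_0_iff)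

lemma sum_nonzero_squares_psi:
  assumes "(2 :: 'a) \<noteq> 0"
  shows "(\<Sum>x\<in>nonzero_squares. \<psi> (a * x)) = (gauss_sum a - 1) / 2"
  using sum_squares_nonzero[OF assms, of "\<lambda>y. \<psi> (a * y)"] by (simp add: sum_nonzero_psi_square)

lemma sum_nonsquares_psi:
  assumes "(2 :: 'a) \<noteq> 0" "a \<noteq> 0"
  shows "(\<Sum>x\<in>nonsquares. \<psi> (a * x)) = (- gauss_sum a - 1) / 2"
proof -
  have "(\<Sum>x\<in>nonsquares. \<psi> (a * x)) =
      (\<Sum>x\<in>UNIV - {0}. \<psi> (a * x)) - (\<Sum>x\<in>nonzero_squares. \<psi> (a * x))"
    by (simp add: sum_nonzero_eq_squares_plus_nonsquares)
  also have "\<dots> = -1 - (gauss_sum a - 1) / 2"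
    by (simp only: sum_nonzero_psi[OF assms(2)] sum_nonzero_squares_psi[OF assms(1)])
  also have "\<dots> = (- gauss_sum a - 1) / 2"
    by (simp add: field_simps)
  finally show ?thesis .
qed

text \<open>A square factor \<open>a = c ^ 2\<close> is absorbed by
  \<open>x \<mapsto> c * x\<close>. A nonsquare \<open>a\<close> carries squares to nonsquares,
  where the sum of \<psi> has the opposite sign of the Gauss sum.\<close>

lemma gauss_sum_eq:
  assumes two: "(2 :: 'a) \<noteq> 0" and "a \<noteq> 0"
  shows "gauss_sum a = of_int (quadratic_char a) * gauss_sum 1"
proof (cases "a \<in> nonsquares")
  case True
  have "(gauss_sum a - 1) / 2 = (\<Sum>x\<in>(\<lambda>x. a * x) ` nonzero_squares. \<psi> x)"
    using \<open>a \<noteq> 0\<close> by (subst sum.reindex) (auto simp: inj_on_def sum_nonzero_squares_psi[OF two])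
  also have "\<dots> = (- gauss_sum 1 - 1) / 2"
    using image_mult_nonsquare[OF two True] sum_nonsquares_psi[OF two, of 1] by simp
  finally have "gauss_sum a - 1 = - gauss_sum 1 - 1"
    by (simp only: divide_cancel_right) simp
  moreover have "quadratic_char a = -1"
    using True unfolding nonsquares_def by blast
  ultimately show ?thesis
    by simp
next
  case False
  then have a: "a \<in> nonzero_squares"
    using \<open>a \<noteq> 0\<close> nonzero_in_squares_or_nonsquares by blast
  then obtain c where c: "c \<noteq> 0" "a = c ^ 2"
    by (auto simp: mem_nonzero_squares_iff)
  have "gauss_sum a = gauss_sum 1"
    unfolding gauss_sum_def
    using c by (intro sum.reindex_bij_witness[of _ "\<lambda>x. x / c" "\<lambda>x. c * x"]) (auto simp: power_mult_distrib)
  then show ?thesis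
    using a by (simp add: nonzero_squares_def)
qed

text \<open>In \<open>gauss_sum 1 * gauss_sum (-1)\<close> the exponent \<open>x ^ 2 - y ^ 2\<close>
  factors as \<open>u * v\<close> with \<open>u = x - y\<close> and \<open>v = x + y\<close>, a
  bijective substitution since \<open>2 \<noteq> 0\<close>. Orthogonality in \<open>v\<close> leaves
  only \<open>u = 0\<close>; the second factor is then rewritten by
  \<open>gauss_sum_eq\<close>.\<close>

lemma gauss_sum_square:
  assumes two: "(2 :: 'a) \<noteq> 0"
  shows "gauss_sum 1 ^ 2 = of_int (quadratic_char (-1 :: 'a)) * of_nat CARD('a)"
proof -
  have "gauss_sum 1 * gauss_sum (-1) = (\<Sum>(x, y)\<in>UNIV \<times> UNIV. \<psi> (x ^ 2 - y ^ 2))"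
    by (simp add: gauss_sum_def sum_product sum.cartesian_product flip: psi_add)
  also have "\<dots> = (\<Sum>(u, v)\<in>UNIV \<times> UNIV. \<psi> (u * v))"
  proof (rule sum.reindex_bij_witness[of _ "\<lambda>(u, v). ((u + v) / 2, (v - u) / 2)" "\<lambda>(x, y). (x - y, x + y)"])
    have half: "(z + z) / 2 = z" for z :: 'a
      using two by (simp flip: mult_2)
    have half2: "z / 2 + z / 2 = z" for z :: 'a
      using half[of z] by (simp add: add_divide_distrib)
    fix z :: "'a \<times> 'a"
    obtain x y where z: "z = (x, y)"
      by fastforce
    show "(case (case z of (x, y) \<Rightarrow> (x - y, x + y)) of (u, v) \<Rightarrow> ((u + v) / 2, (v - u) / 2)) = z"
      using half[of x] half[of y] by (simp add: z)
    show "(case (case z of (u, v) \<Rightarrow> ((u + v) / 2, (v - u) / 2)) of (x, y) \<Rightarrow> (x - y, x + y)) = z"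
      using half2[of x] half2[of y] by (simp add: z add_divide_distrib diff_divide_distrib)
    show "(case (case z of (x, y) \<Rightarrow> (x - y, x + y)) of (u, v) \<Rightarrow> \<psi> (u * v)) =
        (case z of (x, y) \<Rightarrow> \<psi> (x ^ 2 - y ^ 2))"
      by (simp add: z power2_eq_square algebra_simps)
  qed auto
  also have "\<dots> = (\<Sum>u\<in>UNIV. \<Sum>v\<in>UNIV. \<psi> (u * v))"
    by (simp add: sum.cartesian_product)
  also have "\<dots> = of_nat CARD('a)"
    by (simp add: sum_psi_mult)
  finally have *: "gauss_sum 1 * (of_int (quadratic_char (-1 :: 'a)) * gauss_sum 1) = of_nat CARD('a)"
    using gauss_sum_eq[OF two, of "-1"] by simp
  have "of_int (quadratic_char (-1 :: 'a)) * of_int (quadratic_char (-1 :: 'a)) = (1 :: complex)"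
    by (simp add: quadratic_char_def)
  then show ?thesis
    by (metis * mult.commute mult.left_commute mult_1 power2_eq_square)
qed

text \<open>The \<open>j\<close>-th power sum is \<open>gauss_sum (of_nat j * a) - 1\<close>. The
  factor \<open>\<chi>(b)\<close> in \<open>G\<close> adapts to \<open>A_poly\<close>, which
  compares \<open>\<chi>(j)\<close> with \<open>\<chi>(b)\<close>: the Gauss sum at
  \<open>of_nat j * a\<close> is \<open>G\<close> if they agree and \<open>- G\<close> if they are
  opposite.\<close>

lemma distinct_sum_psi_eq_A_poly:
  fixes b :: 'a
  assumes two: "(2 :: 'a) \<noteq> 0" and "a \<noteq> 0" "b \<noteq> 0"
  defines "G \<equiv> of_int (quadratic_char a * quadratic_char b) * gauss_sum 1"
  shows "distinct_sum (\<lambda>x. \<psi> (a * x ^ 2)) k (UNIV - {0}) =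
    (-1) ^ k * A_poly CHAR('a) k b (1 - G) (1 + G) (1 - of_nat CARD('a))"
proof -
  let ?y = "\<lambda>x. \<psi> (a * x ^ 2)" and ?t = "cycle_weight CHAR('a) b (1 - G) (1 + G) (1 - of_nat CARD('a))"
  have "?t j = - (\<Sum>x\<in>UNIV - {0}. ?y x ^ j)" for j
  proof -
    have "(\<Sum>x\<in>UNIV - {0}. ?y x ^ j) = gauss_sum (of_nat j * a) - 1"
      by (simp add: mult.assoc flip: sum_nonzero_psi_square psi_of_nat_mult)
    moreover have "?t j = 1 - gauss_sum (of_nat j * a)"
    proof (cases "CHAR('a) dvd j")
      case True
      then have "(of_nat j :: 'a) = 0"
        by (simp add: of_nat_eq_0_iff_char_dvd)
      then show ?thesis
        using True by (simp add: cycle_weight_def gauss_sum_0)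
    next
      case False
      then have "(of_nat j :: 'a) \<noteq> 0"
        by (simp add: of_nat_eq_0_iff_char_dvd)
      then have j: "quadratic_char (of_nat j :: 'a) = 1 \<or> quadratic_char (of_nat j :: 'a) = -1"
        by (simp add: quadratic_char_def)
      have b: "quadratic_char b = 1 \<or> quadratic_char b = -1"
        using \<open>b \<noteq> 0\<close> by (simp add: quadratic_char_def)
      have "gauss_sum (of_nat j * a) =
          of_int (quadratic_char (of_nat j :: 'a) * quadratic_char a) * gauss_sum 1"
        using \<open>of_nat j \<noteq> 0\<close> \<open>a \<noteq> 0\<close> by (subst gauss_sum_eq[OF two]) (auto simp: quadratic_char_mult[OF two])
      then show ?thesis
        using False j b unfolding cycle_weight_def G_def by auto
    qed
    ultimately show ?thesis
      by simp
  qed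
  then have "(-1) ^ k * distinct_sum ?y k (UNIV - {0}) = A_poly CHAR('a) k b (1 - G) (1 + G) (1 - of_nat CARD('a))"
    unfolding A_poly_eq_cycle_index by (intro distinct_sum_eq_cycle_index) auto
  moreover have "(-1 :: complex) ^ k * (-1) ^ k = 1"
    by (simp flip: power_mult_distrib)
  ultimately show ?thesis
    by (metis mult.assoc mult_1)
qed

text \<open>The equation is detected by \<open>sum_psi_mult\<close>. After swapping sums, \<psi>
  splits over the coordinates into a sum over injective tuples.\<close>

lemma CARD_mult_N_star:
  "of_nat CARD('a) * of_nat (N_star k b) =
    (\<Sum>a\<in>UNIV. \<psi> (- (a * b)) * distinct_sum (\<lambda>x. \<psi> (a * x ^ 2)) k (UNIV - {0}))"
proof -
  let ?T = "{x \<in> {1..k} \<rightarrow>\<^sub>E (UNIV - {0 :: 'a}). inj_on x {1..k}}"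
  have fin: "finite ?T"
    by (rule finite_subset[OF _ finite_PiE[of "{1..k}" "\<lambda>_. UNIV - {0 :: 'a}"]]) auto
  have "N_star k b = card {x \<in> ?T. (\<Sum>i=1..k. x i ^ 2) = b}"
    unfolding N_star_def by (intro arg_cong[where f = card]) (auto simp: inj_on_def)
  also have "\<dots> = (\<Sum>x\<in>?T. if (\<Sum>i=1..k. x i ^ 2) = b then 1 else 0)"
    using fin by (simp add: sum.If_cases Int_def)
  finally have "of_nat CARD('a) * of_nat (N_star k b) =
      (\<Sum>x\<in>?T. if (\<Sum>i=1..k. x i ^ 2) - b = 0 then of_nat CARD('a) else (0 :: complex))"
    by (simp add: sum_distrib_left if_distrib cong: if_cong)
  also have "\<dots> = (\<Sum>x\<in>?T. \<Sum>a\<in>UNIV. \<psi> (((\<Sum>i=1..k. x i ^ 2) - b) * a))"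
    by (simp only: sum_psi_mult)
  also have "\<dots> = (\<Sum>x\<in>?T. \<Sum>a\<in>UNIV. \<psi> (- (a * b)) * (\<Prod>i=1..k. \<psi> (a * x i ^ 2)))"
    by (intro sum.cong refl) (simp add: algebra_simps sum_distrib_left flip: psi_sum psi_add)
  also have "\<dots> = (\<Sum>a\<in>UNIV. \<psi> (- (a * b)) * (\<Sum>x\<in>?T. \<Prod>i=1..k. \<psi> (a * x i ^ 2)))"
    by (subst sum.swap) (simp add: sum_distrib_left)
  also have "(\<lambda>a. \<Sum>x\<in>?T. \<Prod>i=1..k. \<psi> (a * x i ^ 2)) =
      (\<lambda>a. distinct_sum (\<lambda>x. \<psi> (a * x ^ 2)) k (UNIV - {0}))"
  proof
    fix a
    show "(\<Sum>x\<in>?T. \<Prod>i=1..k. \<psi> (a * x i ^ 2)) = distinct_sum (\<lambda>x. \<psi> (a * x ^ 2)) k (UNIV - {0})"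
      using sum_inj_tuples_eq_distinct_sum[of "{1..k}" "UNIV - {0 :: 'a}" "\<lambda>x. \<psi> (a * x ^ 2)"]
      by simp
  qed
  finally show ?thesis .
qed

text \<open>Substituting \<open>a = b * c\<close> turns \<open>\<chi>(a) \<chi>(b)\<close> into
  \<open>\<chi>(c)\<close>, so the inner sum takes just two values, on squares and on nonsquares
  \<open>c\<close>. Their weights are partial sums of \<open>\<psi> (- (b ^ 2) * c)\<close>,
  governed by \<open>gauss_sum (- (b ^ 2)) = \<epsilon> * G\<close>.\<close>

lemma N_star_eq_gauss_sum:
  fixes b :: 'a
  assumes two: "(2 :: 'a) \<noteq> 0" and b: "b \<noteq> 0"
  defines "G \<equiv> gauss_sum 1" and "q \<equiv> of_nat CARD('a)"
    and "\<epsilon> \<equiv> of_int (quadratic_char (-1 :: 'a))"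
  shows "of_nat (N_star k b) = falling_fact (q - 1) k / q
    - (-1) ^ k / (2 * q) *
      ((1 - \<epsilon> * G) * A_poly CHAR('a) k b (1 - G) (1 + G) (1 - q)
       + (1 + \<epsilon> * G) * A_poly CHAR('a) k b (1 + G) (1 - G) (1 - q))"
proof -
  let ?D = "\<lambda>a. distinct_sum (\<lambda>x. \<psi> (a * x ^ 2)) k (UNIV - {0})"
  let ?A = "\<lambda>G. A_poly CHAR('a) k b (1 - G) (1 + G) (1 - q)"
  have b2: "quadratic_char b * quadratic_char b = 1"
    using b by (simp add: quadratic_char_def)
  have "quadratic_char (- (b ^ 2)) = quadratic_char (-1 :: 'a)"
    using quadratic_char_mult[OF two, of "-1" "b * b"] quadratic_char_mult[OF two, of b b] b2
    by (simp add: power2_eq_square)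
  moreover have b2_nonzero: "- (b ^ 2) \<noteq> 0"
    using b by simp
  then have "gauss_sum (- (b ^ 2)) = of_int (quadratic_char (- (b ^ 2))) * gauss_sum 1"
    by (rule gauss_sum_eq[OF two])
  ultimately have gauss: "gauss_sum (- (b ^ 2)) = \<epsilon> * G"
    by (simp only: \<epsilon>_def G_def)
  have D: "?D (b * c) = (-1) ^ k * ?A (of_int (quadratic_char c) * G)" if "c \<noteq> 0" for c
  proof -
    have "quadratic_char (b * c) * quadratic_char b = quadratic_char c"
      using b2 by (simp add: quadratic_char_mult[OF two] mult.commute mult.left_commute)
    then show ?thesis
      using distinct_sum_psi_eq_A_poly[OF two, of "b * c" b k] b that by (simp add: G_def q_def)
  qed
  have "(\<Sum>a\<in>UNIV - {0}. \<psi> (- (a * b)) * ?D a) =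
      (\<Sum>c\<in>UNIV - {0}. \<psi> (- (b ^ 2) * c) * ?D (b * c))"
    using b by (intro sum.reindex_bij_witness[of _ "\<lambda>c. b * c" "\<lambda>a. a / b"])
      (auto simp: power2_eq_square mult.commute)
  also have "\<dots> = (\<Sum>c\<in>nonzero_squares. \<psi> (- (b ^ 2) * c) * ((-1) ^ k * ?A G))
      + (\<Sum>c\<in>nonsquares. \<psi> (- (b ^ 2) * c) * ((-1) ^ k * ?A (- G)))"
    unfolding sum_nonzero_eq_squares_plus_nonsquares
  proof (intro arg_cong2[where f = "(+)"] sum.cong refl)
    fix c :: 'a assume c: "c \<in> nonzero_squares"
    then show "\<psi> (- (b ^ 2) * c) * ?D (b * c) = \<psi> (- (b ^ 2) * c) * ((-1) ^ k * ?A G)"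
      using D[of c] by (auto simp: nonzero_squares_def quadratic_char_eq_0_iff[symmetric])
  next
    fix c :: 'a assume c: "c \<in> nonsquares"
    then show "\<psi> (- (b ^ 2) * c) * ?D (b * c) = \<psi> (- (b ^ 2) * c) * ((-1) ^ k * ?A (- G))"
      using D[of c] by (auto simp: nonsquares_def quadratic_char_eq_0_iff[symmetric])
  qed
  also have "\<dots> = (\<epsilon> * G - 1) / 2 * ((-1) ^ k * ?A G) + (- (\<epsilon> * G) - 1) / 2 * ((-1) ^ k * ?A (- G))"
    by (simp only: sum_distrib_right[symmetric] sum_nonzero_squares_psi[OF two]
        sum_nonsquares_psi[OF two b2_nonzero] gauss)
  finally have rest: "(\<Sum>a\<in>UNIV - {0}. \<psi> (- (a * b)) * ?D a) = \<dots>" .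
  have "q \<noteq> 0"
    by (simp add: q_def)
  \<comment> \<open>The term \<open>a = 0\<close>, where every \<psi>-value is 1, counts all
    injective tuples of nonzero elements.\<close>
  have "of_nat (card (UNIV - {0 :: 'a})) = q - 1"
    by (simp add: q_def of_nat_diff Suc_leI)
  then have "?D 0 = falling_fact (q - 1) k"
    by (simp add: psi_0 distinct_sum_const_one)
  then have "q * of_nat (N_star k b) = falling_fact (q - 1) k
      + ((\<epsilon> * G - 1) / 2 * ((-1) ^ k * ?A G) + (- (\<epsilon> * G) - 1) / 2 * ((-1) ^ k * ?A (- G)))"
    using rest CARD_mult_N_star[of k b] by (simp add: q_def sum.remove[of UNIV "0 :: 'a"] psi_0)
  then have "of_nat (N_star k b) = (falling_fact (q - 1) k
      + ((\<epsilon> * G - 1) / 2 * ((-1) ^ k * ?A G) + (- (\<epsilon> * G) - 1) / 2 * ((-1) ^ k * ?A (- G)))) / q"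
    using \<open>q \<noteq> 0\<close> by (metis nonzero_mult_div_cancel_left)
  also have "\<dots> = falling_fact (q - 1) k / q
      - (-1) ^ k / (2 * q) * ((1 - \<epsilon> * G) * ?A G + (1 + \<epsilon> * G) * ?A (- G))"
    using \<open>q \<noteq> 0\<close> by (simp add: field_simps)
  finally show ?thesis
    by simp
qed

end

section \<open>The two cases, according to \<open>q\<close> modulo 4\<close>

theorem theorem4p5:
  fixes p s q k :: nat and b :: "'a::{field,finite}"
  assumes "prime p" and "odd p" and "s \<ge> 1" and "q = p ^ s" and "CARD('a) = q"
    and "k \<ge> 1" and "b \<noteq> 0"
  shows "let r = complex_of_real (sqrt (real q)) in
    (p mod 4 = 1 \<or> (p mod 4 = 3 \<and> even s) \<longrightarrow>
      of_nat (N_star k b) =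
        falling_fact (of_nat q - 1) k / of_nat q
        - (-1) ^ k / (2 * of_nat q) *
          ((1 - r) * A_poly p k b (1 - r) (1 + r) (1 - of_nat q)
           + (1 + r) * A_poly p k b (1 + r) (1 - r) (1 - of_nat q)))
    \<and> (p mod 4 = 3 \<and> odd s \<longrightarrow>
      of_nat (N_star k b) =
        falling_fact (of_nat q - 1) k / of_nat q
        - (-1) ^ k / (2 * of_nat q) *
          ((1 + r * \<i>) * A_poly p k b (1 - r * \<i>) (1 + r * \<i>) (1 - of_nat q)
           + (1 - r * \<i>) * A_poly p k b (1 + r * \<i>) (1 - r * \<i>) (1 - of_nat q)))"
proof -
  define r where "r = complex_of_real (sqrt (real q))"
  have card: "CARD('a) = p ^ s"
    using assms by simp
  have char: "CHAR('a) = p"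
    using assms(1) card by (rule CHAR_eq_of_CARD_prime_power)
  obtain \<psi> :: "'a \<Rightarrow> complex" where "additive_character \<psi>"
    using additive_character_exists[OF assms(1) card assms(3)] by blast
  then interpret additive_character \<psi> .
  have "\<not> p dvd 2"
    using assms(1,2) by (metis primes_dvd_imp_eq two_is_prime_nat dvd_refl)
  then have two: "(2 :: 'a) \<noteq> 0"
    using of_nat_eq_0_iff_char_dvd[of 2, where 'a = 'a] char by simp
  have "odd CARD('a)"
    using card assms(2) by simp
  note eps = quadratic_char_minus_one[OF this two]
  have r2: "r ^ 2 = of_nat q"
    by (simp add: r_def flip: of_real_power)
  have mod_q: "q mod 4 = (p mod 4) ^ s mod 4"
    by (simp add: assms(4) power_mod)
  note N = N_star_eq_gauss_sum[OF two \<open>b \<noteq> 0\<close>, of k]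
  note G2 = gauss_sum_square[OF two]
  \<comment> \<open>An even power of 3 is a power of 9, and 9 is 1 modulo 4.\<close>
  have nine: "(3 :: nat) ^ (2 * n) mod 4 = 1" for n
    using power_mod[of "9 :: nat" 4 n] by (simp add: power_mult)
  show ?thesis
    unfolding Let_def r_def[symmetric]
  proof (intro conjI impI)
    assume "p mod 4 = 1 \<or> p mod 4 = 3 \<and> even s"
    then have "q mod 4 = 1"
      using mod_q nine by auto
    then have e: "quadratic_char (-1 :: 'a) = 1"
      using eps assms(5) by simp
    \<comment> \<open>This fixes the Gauss sum up to sign; changing the sign only exchanges the two
      summands in the braces.\<close>
    have "gauss_sum 1 ^ 2 = r ^ 2"
      using G2 e r2 assms(5) by simp
    then consider "gauss_sum 1 = r" | "gauss_sum 1 = - r"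
      by (auto simp: power2_eq_iff)
    then show "of_nat (N_star k b) =
        falling_fact (of_nat q - 1) k / of_nat q
        - (-1) ^ k / (2 * of_nat q) *
          ((1 - r) * A_poly p k b (1 - r) (1 + r) (1 - of_nat q)
           + (1 + r) * A_poly p k b (1 + r) (1 - r) (1 - of_nat q))"
      by cases (use N in \<open>simp_all add: e char assms(5) add.commute\<close>)
  next
    assume p: "p mod 4 = 3 \<and> odd s"
    then obtain n where "s = 2 * n + 1"
      by (auto elim: oddE)
    then have "q mod 4 = 3 * (3 ^ (2 * n) mod 4) mod 4"
      using mod_q p by (simp add: mod_mult_right_eq)
    then have "q mod 4 = 3"
      by (simp add: nine)
    then have e: "quadratic_char (-1 :: 'a) = -1"
      using eps assms(5) by simp
    \<comment> \<open>Here \<open>\<chi>(-1) = -1\<close>, so the square is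
      \<open>- of_nat q\<close>. The same value of \<open>\<epsilon>\<close> makes the outer factor
      \<open>1 - \<epsilon> * G\<close> equal to \<open>1 + G\<close>, opposite in sign to the first
      case.\<close>
    have "gauss_sum 1 ^ 2 = (r * \<i>) ^ 2"
      using G2 e r2 assms(5) by (simp add: power_mult_distrib)
    then consider "gauss_sum 1 = r * \<i>" | "gauss_sum 1 = - (r * \<i>)"
      by (auto simp only: power2_eq_iff)
    then show "of_nat (N_star k b) =
        falling_fact (of_nat q - 1) k / of_nat q
        - (-1) ^ k / (2 * of_nat q) *
          ((1 + r * \<i>) * A_poly p k b (1 - r * \<i>) (1 + r * \<i>) (1 - of_nat q)
           + (1 - r * \<i>) * A_poly p k b (1 + r * \<i>) (1 - r * \<i>) (1 - of_nat q))"
      by cases (use N in \<open>simp_all add: e char assms(5) add.commute\<close>)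
  qed
qed

end
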